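(* Let $a,b:[0,\infty)\to\mathbb{R}$ be positive continuous functions with $b$ non-decreasing, and let $0<x_0\le x_1$. Assume that the nonnegative extended-real-valued functions $u,v$ on $[0,\infty)$ satisfy $$v(t)\ge x_1+\int_0^t a(s)\,b(v(s))\,ds\quad\text{and}\quad u(t)=x_0+\int_0^t a(s)\,b(u(s))\,ds,\qquad t\ge0.$$ Then $v(t)\ge u(t)$ for every $t\ge0$, and $T_e^v\le A^{-1}(B(\infty))$.
   Context: $A:[0,\infty)\to\mathbb{R}$ is $A(t)=\int_0^t a(s)\,ds$ and $B:[x_0,\infty)\to\mathbb{R}$ is $B(x)=\int_{x_0}^x\frac{ds}{b(s)}$; both are continuous and strictly increasing, with limits $A(\infty),B(\infty)\in(0,\infty]$ at $\infty$. Convention: $A^{-1}(s)=\infty$ if $s\ge A(\infty)$. The time of explosion of $v$ is $T_e^v=\sup\{t\ge0:v(t)<\infty\}\in[0,\infty]$. Conventions for extended-valued functions: $b(\infty)=\lim_{x\to\infty}b(x)\in(0,\infty]$; $v$ is measurable; $u$, as a solution of its integral equation, is continuous as a map from $[0,\infty)$ to $[0,\infty]$ (so it can become infinite only by growing continuously to $\infty$). *)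

theory Defs
  imports "HOL-Analysis.Analysis"
begin

text \<open>Functions on the half-line \<open>[0, \<infinity>)\<close> with values in \<open>[0, \<infinity>]\<close> are rendered as
  \<^typ>\<open>real \<Rightarrow> ennreal\<close>; only their values at nonnegative arguments are ever used.\<close>

definition ext_infty :: "(real \<Rightarrow> real) \<Rightarrow> ennreal \<Rightarrow> ennreal" where
  "ext_infty b x =
     (if x = \<infinity> then Lim at_top (\<lambda>y. ennreal (b y)) else ennreal (b (enn2real x)))"

definition primA :: "(real \<Rightarrow> real) \<Rightarrow> real \<Rightarrow> real" where
  "primA a t = integral {0..t} a"

definition primB :: "(real \<Rightarrow> real) \<Rightarrow> real \<Rightarrow> real \<Rightarrow> real" where
  "primB b x0 x = integral {x0..x} (\<lambda>s. 1 / b s)"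

definition primA_infty :: "(real \<Rightarrow> real) \<Rightarrow> ennreal" where
  "primA_infty a = Lim at_top (\<lambda>t. ennreal (primA a t))"

definition primB_infty :: "(real \<Rightarrow> real) \<Rightarrow> real \<Rightarrow> ennreal" where
  "primB_infty b x0 = Lim at_top (\<lambda>x. ennreal (primB b x0 x))"

definition primA_inv :: "(real \<Rightarrow> real) \<Rightarrow> ennreal \<Rightarrow> ennreal" where
  "primA_inv a s =
     (if s \<ge> primA_infty a then \<infinity>
      else ennreal (the_inv_into {0..} (primA a) (enn2real s)))"

text \<open>The supremum is taken in \<open>[0, \<infinity>]\<close>, so it is 0 if \<open>v\<close> is infinite everywhere.\<close>

definition explosion_time :: "(real \<Rightarrow> ennreal) \<Rightarrow> ennreal" where
  "explosion_time v = (SUP t \<in> {t. 0 \<le> t \<and> v t < \<infinity>}. ennreal t)"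

end

(*
  Let w(t) denote the right-hand side of the inequality for v. Then w <= v, and w is finite and
  continuous wherever v is finite, but it need not be differentiable since v is only measurable.
  Hence the differential inequality (B o w)' >= a is replaced by the increment estimate
    b(w r) (A s - A r) <= w s - w r <= b(w s) (B(w s) - B(w r))  for r <= s,
  whose factors b(w r), b(w s) are nearly equal on short intervals. Bolzano's principle turns it
  into A(t) <= B(w t). The same argument with the inequalities reversed gives B(u t) <= A(t), so
  u <= w <= v. If v(t) is finite, A(t) <= B(w t) <= B(infinity) bounds t. Finally, u cannot be
  infinite where w is finite, since u would first take a finite value above w(t).
*)

theory Submission
  imports Defs
begin

section \<open>Monotone limits and comparison of increments\<close>

lemma Lim_at_top_mono_on:
  fixes f :: "real \<Rightarrow> 'a::{complete_linorder,linorder_topology}"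
  assumes "mono_on {c..} f"
  shows "Lim at_top f = (SUP x\<in>{c..}. f x)"
proof -
  have "(f \<longlongrightarrow> (SUP x\<in>{c..}. f x)) at_top"
  proof (rule increasing_tendsto)
    show "\<forall>\<^sub>F x in at_top. f x \<le> (SUP x\<in>{c..}. f x)"
      using eventually_ge_at_top[of c] by eventually_elim (auto intro: SUP_upper)
  next
    fix l assume "l < (SUP x\<in>{c..}. f x)"
    then obtain x where x: "c \<le> x" "l < f x" by (auto simp: less_SUP_iff)
    show "\<forall>\<^sub>F y in at_top. l < f y"
      using eventually_ge_at_top[of x]
      by eventually_elim (use x mono_onD[OF assms] in \<open>force intro: less_le_trans\<close>)
  qed
  then show ?thesis by (intro tendsto_Lim) auto
qed

text \<open>By continuity the ratio \<open>\<rho> r / \<rho> s\<close> is close to 1 on short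
  intervals, so for each \<open>l < 1\<close> the local hypothesis gives
  \<open>l * (G s - G r) \<le> F s - F r\<close> there. That inequality is additive over adjacent
  intervals, hence holds on the whole interval, and \<open>l\<close> may tend to 1. No
  differentiability of \<open>F\<close> or \<open>G\<close> enters.\<close>

lemma increment_le_from_local:
  fixes F G \<rho> :: "real \<Rightarrow> real"
  assumes "p \<le> q" and cont: "continuous_on {p..q} \<rho>"
    and pos: "\<And>x. x \<in> {p..q} \<Longrightarrow> 0 < \<rho> x"
    and mono: "mono_on {p..q} G"
    and loc: "\<And>r s. p \<le> r \<Longrightarrow> r \<le> s \<Longrightarrow> s \<le> q \<Longrightarrow>
      \<rho> r * (G s - G r) \<le> \<rho> s * (F s - F r)"
  shows "G q - G p \<le> F q - F p"
proof -
  have scaled: "l * (G q - G p) \<le> F q - F p" if l: "0 < l" "l < 1" for l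
  proof -
    \<comment> \<open>The trivial premise is the instance at the endpoints of a guard: the short
      intervals around \<open>x\<close> in Bolzano's principle may reach outside
      \<open>{p..q}\<close>, where the claim has to be vacuous.\<close>
    have "p \<le> p \<and> q \<le> q \<longrightarrow> l * (G q - G p) \<le> F q - F p"
      using \<open>p \<le> q\<close>
    proof (induction rule: Bolzano[where P="\<lambda>r s. p \<le> r \<and> s \<le> q \<longrightarrow> l * (G s - G r) \<le> F s - F r"])
      case (trans r s t)
      then show ?case by (auto simp: algebra_simps)
    next
      case (local x)
      \<comment> \<open>This tolerance yields
        \<open>l * (\<rho> x + ?e) \<le> \<rho> x - ?e\<close>, the difference of the two sides
        being \<open>\<rho> x * (1 - l)\<^sup>2 / 2\<close>.\<close>
      let ?e = "(1 - l) / 2 * \<rho> x"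
      have px: "0 < \<rho> x" using pos local by auto
      then have "?e > 0" using l by simp
      then obtain d where d: "d > 0"
        "\<And>y. y \<in> {p..q} \<Longrightarrow> dist y x < d \<Longrightarrow> dist (\<rho> y) (\<rho> x) < ?e"
        using cont local unfolding continuous_on_iff by (metis atLeastAtMost_iff)
      show ?case
      proof (intro exI[of _ d] conjI allI impI d(1))
        fix r s assume rs: "r \<le> x \<and> x \<le> s \<and> s - r < d" "p \<le> r \<and> s \<le> q"
        have "\<bar>\<rho> r - \<rho> x\<bar> < ?e" "\<bar>\<rho> s - \<rho> x\<bar> < ?e"
          using d(2)[of r] d(2)[of s] rs by (auto simp: dist_real_def)
        then have 1: "\<rho> r > \<rho> x - ?e" "\<rho> s < \<rho> x + ?e" by linarith+
        have "l * \<rho> s \<le> l * (\<rho> x + ?e)" using 1 l by (intro mult_left_mono) auto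
        also have "\<dots> \<le> \<rho> x - ?e"
        proof -
          have "\<rho> x - ?e - l * (\<rho> x + ?e) = \<rho> x * ((1 - l)\<^sup>2 / 2)"
            by (simp add: field_simps power2_eq_square)
          moreover have "\<rho> x * ((1 - l)\<^sup>2 / 2) \<ge> 0" using px by simp
          ultimately show ?thesis by linarith
        qed
        finally have lr: "l * \<rho> s \<le> \<rho> r" using 1 by linarith
        have G: "G r \<le> G s" using rs by (intro mono_onD[OF mono]) auto
        have "(l * \<rho> s) * (G s - G r) \<le> \<rho> r * (G s - G r)"
          using lr G by (intro mult_right_mono) auto
        also have "\<dots> \<le> \<rho> s * (F s - F r)" using loc rs by simp
        finally have "\<rho> s * (l * (G s - G r)) \<le> \<rho> s * (F s - F r)" by (simp add: algebra_simps)
        then show "l * (G s - G r) \<le> F s - F r"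
          using pos[of s] rs by simp
      qed
    qed
    then show ?thesis by simp
  qed
  have "((\<lambda>l. l * (G q - G p)) \<longlongrightarrow> 1 * (G q - G p)) (at_left 1)"
    by (intro tendsto_intros)
  moreover have "\<forall>\<^sub>F l in at_left 1. l * (G q - G p) \<le> F q - F p"
    using eventually_at_left_real[of 0 1] by (auto elim!: eventually_mono intro: scaled)
  ultimately have "1 * (G q - G p) \<le> F q - F p"
    by (intro tendsto_upperbound) auto
  then show ?thesis by simp
qed

section \<open>Monotonicity and measurability of the extension of \<open>b\<close> to
  infinity\<close>

lemma ennreal_le_ext_infty:
  assumes b: "mono_on {0..} b" and "0 \<le> y" "ennreal y \<le> x"
  shows "ennreal (b y) \<le> ext_infty b x"
proof (cases "x = \<infinity>")
  case True
  \<comment> \<open>Monotonicity identifies the value at infinity with the supremum of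
    \<open>b\<close> on \<open>{0..}\<close>, which dominates \<open>b y\<close>.\<close>
  have "mono_on {0..} (\<lambda>y. ennreal (b y))"
    using b by (auto simp: mono_on_def intro!: ennreal_leI)
  then show ?thesis
    using True \<open>0 \<le> y\<close> by (auto simp: ext_infty_def Lim_at_top_mono_on intro!: SUP_upper)
next
  case False
  then have "y \<le> enn2real x"
    using assms by (cases x) (auto simp: ennreal_le_iff)
  then show ?thesis
    using False assms(2) mono_onD[OF b, of y "enn2real x"] by (auto simp: ext_infty_def intro!: ennreal_leI)
qed

lemma ext_infty_le_ennreal:
  assumes b: "mono_on {0..} b" and "0 \<le> y" "x \<le> ennreal y"
  shows "ext_infty b x \<le> ennreal (b y)"
  using assms(2,3) mono_onD[OF b, of "enn2real x" y]
  by (cases x) (auto simp: ext_infty_def top_unique intro!: ennreal_leI)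

lemma ext_infty_measurable:
  assumes b: "mono_on {0..} b"
  shows "ext_infty b \<in> borel_measurable borel"
proof -
  \<comment> \<open>Nothing is known about \<open>b\<close> at negative arguments; composing with
    \<open>max 0\<close> gives a function monotone on the whole line, hence Borel.\<close>
  have "mono (\<lambda>x. b (max 0 x))"
    using b by (auto simp: mono_def mono_on_def)
  then have [measurable]: "(\<lambda>x. b (max 0 x)) \<in> borel_measurable borel"
    by (rule borel_measurable_mono)
  have "ext_infty b = (\<lambda>x. if x = \<infinity> then Lim at_top (\<lambda>y. ennreal (b y))
      else ennreal (b (max 0 (enn2real x))))"
    by (auto simp: ext_infty_def fun_eq_iff)
  then show ?thesis by simp
qed

section \<open>Integrals of a continuous function on a half-line\<close>

context
  fixes f :: "real \<Rightarrow> real" and c :: real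
  assumes cont: "continuous_on {c..} f"
begin

lemma integrable_on_halfline: "c \<le> r \<Longrightarrow> f integrable_on {r..s}"
  by (intro integrable_continuous_interval continuous_on_subset[OF cont]) auto

lemma integral_diff_halfline:
  "c \<le> r \<Longrightarrow> r \<le> s \<Longrightarrow> integral {c..s} f - integral {c..r} f = integral {r..s} f"
  using Henstock_Kurzweil_Integration.integral_combine[where f=f and a=c and c=r and b=s] integrable_on_halfline[of c s] by simp

lemma strict_mono_on_integral_halfline:
  assumes pos: "\<And>x. c \<le> x \<Longrightarrow> 0 < f x"
  shows "strict_mono_on {c..} (\<lambda>x. integral {c..x} f)"
proof (rule strict_mono_onI)
  fix r s assume rs: "r \<in> {c..}" "s \<in> {c..}" "r < s"
  have "0 \<le> integral {r..s} f"
    using rs pos by (intro integral_nonneg integrable_on_halfline) (auto simp: less_imp_le)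
  \<comment> \<open>A continuous nonnegative function with zero integral vanishes at every point, in
    particular at \<open>r\<close>, contradicting positivity.\<close>
  moreover have "integral {r..s} f \<noteq> 0"
  proof
    assume "integral {r..s} f = 0"
    then have "(f has_integral 0) (cbox r s)"
      using integrable_on_halfline[of r s] rs by (auto simp: has_integral_integral)
    then have "f r = 0"
      using rs pos continuous_on_subset[OF cont, of "{r..s}"]
      by (intro has_integral_0_cbox_imp_0[of r s f r]) (auto simp: less_imp_le)
    then show False using pos[of r] rs by auto
  qed
  ultimately show "integral {c..r} f < integral {c..s} f"
    using integral_diff_halfline[of r s] rs by auto
qed

text \<open>Evaluates the Lebesgue integral that arises once the factor \<open>b (v x)\<close> has
  been estimated by a constant \<open>k\<close>. The interval is half-open so that it can be
  adjoined disjointly to \<open>{0..r}\<close>.\<close>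

lemma set_nn_integral_halfline:
  assumes "c \<le> r" "r \<le> s" "0 \<le> k" and nonneg: "\<And>x. c \<le> x \<Longrightarrow> 0 \<le> f x"
  shows "(\<integral>\<^sup>+x\<in>{r<..s}. ennreal (f x) * ennreal k \<partial>lebesgue)
    = ennreal (k * (integral {c..s} f - integral {c..r} f))"
proof -
  have "(f has_integral integral {r..s} f) {r..s}"
    using integrable_on_halfline[OF assms(1)] by (simp add: has_integral_integral)
  then have "(f has_integral integral {r..s} f) {r<..s}"
    by (rule iffD1[OF has_integral_spike_set_eq, rotated 2]) (auto intro: negligible_subset[of "{r}"])
  then have "((\<lambda>x. k * f x) has_integral k * integral {r..s} f) {r<..s}"
    by (rule has_integral_mult_right)
  then have "(\<integral>\<^sup>+x\<in>{r<..s}. ennreal (k * f x) \<partial>lborel) = ennreal (k * integral {r..s} f)"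
    using assms by (intro nn_integral_has_integral_lebesgue') auto
  moreover have "(\<integral>\<^sup>+x\<in>{r<..s}. ennreal (f x) * ennreal k \<partial>lebesgue)
      = (\<integral>\<^sup>+x\<in>{r<..s}. ennreal (k * f x) \<partial>lborel)"
    unfolding nn_integral_completion
    using assms by (intro nn_integral_cong) (auto simp: indicator_def ennreal_mult mult.commute)
  ultimately show ?thesis using assms integral_diff_halfline by simp
qed

end

section \<open>Indefinite Lebesgue integrals of extended-valued functions\<close>

context
  fixes h :: "real \<Rightarrow> ennreal" and H :: "real \<Rightarrow> ennreal"
  assumes meas: "h \<in> borel_measurable (lebesgue_on {0..})"
  defines "H \<equiv> \<lambda>t. \<integral>\<^sup>+x\<in>{0..t}. h x \<partial>lebesgue"
begin

lemma measurable_times_indicator_halfline: "(\<lambda>x. h x * indicator {0..} x) \<in> borel_measurable lebesgue"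
  using meas by (subst (asm) borel_measurable_restrict_space_iff_ennreal) auto

lemma nn_integral_split:
  assumes "0 \<le> r" "r \<le> s"
  shows "H s = H r + (\<integral>\<^sup>+x\<in>{r<..s}. h x \<partial>lebesgue)"
proof -
  \<comment> \<open>Additivity over disjoint sets requires measurability on the whole line, while
    \<open>h\<close> is measurable only on \<open>{0..}\<close>; on subsets of \<open>{0..}\<close>
    the cut-off leaves the integrals unchanged.\<close>
  let ?k = "\<lambda>x. h x * indicator {0..} x"
  note measurable_times_indicator_halfline [measurable]
  have *: "(\<integral>\<^sup>+x\<in>S. h x \<partial>lebesgue) = (\<integral>\<^sup>+x\<in>S. ?k x \<partial>lebesgue)" if "S \<subseteq> {0..}" for S
    using that by (intro nn_integral_cong) (auto simp: indicator_def)
  have "{0..s} = {0..r} \<union> {r<..s}" using assms by auto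
  moreover have "(\<integral>\<^sup>+x\<in>{0..r} \<union> {r<..s}. ?k x \<partial>lebesgue)
      = (\<integral>\<^sup>+x\<in>{0..r}. ?k x \<partial>lebesgue) + (\<integral>\<^sup>+x\<in>{r<..s}. ?k x \<partial>lebesgue)"
    by (rule nn_integral_disjoint_pair) auto
  ultimately show ?thesis
    unfolding H_def using assms by (subst (1 2 3) *) auto
qed

text \<open>A finite integral forces \<open>h\<close> to be finite almost everywhere on
  \<open>{0..t}\<close>. There \<open>h\<close> can be replaced by a real integrable function, whose
  indefinite integral is continuous.\<close>

lemma continuous_on_nn_integral_upper:
  assumes fin: "H t < \<infinity>"
  shows "continuous_on {0..t} (\<lambda>s. enn2real (H s))"
proof -
  \<comment> \<open>\<open>enn2real\<close> sends infinity to 0, which changes the integrand only on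
    a null set.\<close>
  define g where "g x = enn2real (h x * indicator {0..} x * indicator {0..t} x)" for x
  have [measurable]:
    "(\<lambda>x. h x * indicator {0..} x * indicator {0..t} x) \<in> borel_measurable lebesgue"
    by (intro borel_measurable_times_ennreal measurable_times_indicator_halfline borel_measurable_indicator) auto
  have [measurable]: "g \<in> borel_measurable lebesgue" unfolding g_def by measurable
  have g_nonneg: "0 \<le> g x" for x by (simp add: g_def)
  have Heq: "H s = (\<integral>\<^sup>+x. h x * indicator {0..} x * indicator {0..s} x \<partial>lebesgue)" for s
    unfolding H_def by (intro nn_integral_cong) (auto simp: indicator_def)
  have "AE x in lebesgue. h x * indicator {0..} x * indicator {0..t} x \<noteq> \<infinity>"
    using fin unfolding Heq by (intro nn_integral_PInf_AE) auto
  then have Hg: "H s = (\<integral>\<^sup>+x. ennreal (g x * indicator {0..s} x) \<partial>lebesgue)" if "s \<le> t" for s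
    unfolding Heq using that
    by (intro nn_integral_cong_AE) (auto simp: g_def indicator_def less_top elim!: eventually_mono)
  have int: "set_integrable lebesgue {0..s} g" if "s \<le> t" for s
  proof -
    have "H s < \<infinity>" using nn_set_integral_set_mono[of "{0..s}" "{0..t}" lebesgue h] that fin
      by (auto simp: H_def intro: le_less_trans)
    then show ?thesis
      unfolding set_integrable_def using Hg[OF that]
      by (intro integrableI_nonneg borel_measurable_scaleR borel_measurable_indicator)
        (auto simp: mult.commute g_nonneg)
  qed
  have "enn2real (H s) = integral {0..s} g" if "s \<le> t" for s
  proof -
    have "H s = ennreal (LINT x:{0..s}|lebesgue. g x)"
      unfolding Hg[OF that] set_lebesgue_integral_def
      using int[OF that] unfolding set_integrable_def
      by (subst nn_integral_eq_integral) (auto simp: g_def mult.commute)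
    moreover have "0 \<le> integral {0..s} g"
      using set_lebesgue_integral_eq_integral[OF int[OF that]]
      by (intro integral_nonneg) (auto simp: g_def)
    ultimately show ?thesis
      using set_lebesgue_integral_eq_integral[OF int[OF that]] by simp
  qed
  moreover have "continuous_on {0..t} (\<lambda>s. integral {0..s} g)"
    using set_lebesgue_integral_eq_integral(1)[OF int[of t]]
    by (intro indefinite_integral_continuous_1) auto
  ultimately show ?thesis by (simp cong: continuous_on_cong_simp)
qed

end

section \<open>The primitives \<open>A\<close> and \<open>B\<close>\<close>

context
  fixes a b :: "real \<Rightarrow> real" and x0 :: real
  assumes a_cont: "continuous_on {0..} a" and a_pos: "\<And>t. 0 \<le> t \<Longrightarrow> 0 < a t"
    and b_cont: "continuous_on {0..} b" and b_pos: "\<And>x. 0 \<le> x \<Longrightarrow> 0 < b x"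
    and b_mono: "mono_on {0..} b"
    and x0_pos: "0 < x0"
begin

lemma strict_mono_on_primA: "strict_mono_on {0..} (primA a)"
  using strict_mono_on_integral_halfline[OF a_cont a_pos] unfolding primA_def .

lemma inverse_b_continuous: "continuous_on {x0..} (\<lambda>x. 1 / b x)"
  using x0_pos b_pos by (intro continuous_intros continuous_on_subset[OF b_cont]) (auto simp: less_le)

lemma strict_mono_on_primB: "strict_mono_on {x0..} (primB b x0)"
  unfolding primB_def using b_pos x0_pos
  by (intro strict_mono_on_integral_halfline inverse_b_continuous) auto

text \<open>Since \<open>b\<close> is non-decreasing, \<open>1 / b\<close> lies between
  \<open>1 / b z\<close> and \<open>1 / b y\<close> on \<open>{y..z}\<close>; these bounds take the
  place of the chain rule for \<open>B\<close> composed with \<open>w\<close>.\<close>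

lemma primB_diff_bounds:
  assumes "x0 \<le> y" "y \<le> z"
  shows "b y * (primB b x0 z - primB b x0 y) \<le> z - y"
    and "z - y \<le> b z * (primB b x0 z - primB b x0 y)"
proof -
  have I: "primB b x0 z - primB b x0 y = integral {y..z} (\<lambda>x. 1 / b x)"
    unfolding primB_def using integral_diff_halfline[OF inverse_b_continuous] assms by simp
  have int: "(\<lambda>x. 1 / b x) integrable_on {y..z}"
    using integrable_on_halfline[OF inverse_b_continuous] assms by simp
  have b: "b y \<le> b x" "b x \<le> b z" "0 < b x" if "x \<in> {y..z}" for x
    using that assms x0_pos b_pos by (auto intro!: mono_onD[OF b_mono])
  have "integral {y..z} (\<lambda>x. 1 / b x) \<le> integral {y..z} (\<lambda>x. 1 / b y)"
    using b assms x0_pos b_pos by (intro integral_le int) (auto simp: frac_le)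
  then show "b y * (primB b x0 z - primB b x0 y) \<le> z - y"
    using b_pos[of y] assms x0_pos by (simp add: I field_simps)
  have "integral {y..z} (\<lambda>x. 1 / b z) \<le> integral {y..z} (\<lambda>x. 1 / b x)"
    using b assms x0_pos b_pos by (intro integral_le int) (auto simp: frac_le)
  then show "z - y \<le> b z * (primB b x0 z - primB b x0 y)"
    using b_pos[of z] assms x0_pos by (simp add: I field_simps)
qed

lemma ext_integrand_measurable:
  assumes "v \<in> borel_measurable (lebesgue_on {0..})"
  shows "(\<lambda>s. ennreal (a s) * ext_infty b (v s)) \<in> borel_measurable (lebesgue_on {0..})"
proof -
  note assms [measurable] ext_infty_measurable[OF b_mono, measurable]
  have [measurable]: "a \<in> borel_measurable (lebesgue_on {0..})"
    using a_cont by (intro continuous_imp_measurable_on_sets_lebesgue) auto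
  show ?thesis by measurable
qed

section \<open>The right-hand side of the integral inequality, up to a time at which it is
  finite\<close>

context
  fixes v :: "real \<Rightarrow> ennreal" and c t :: real and J :: "real \<Rightarrow> ennreal" and w :: "real \<Rightarrow> real"
  assumes v_meas: "v \<in> borel_measurable (lebesgue_on {0..})"
    and x0_le_c: "x0 \<le> c" and t_nonneg: "0 \<le> t"
  defines "J \<equiv> \<lambda>t. ennreal c + (\<integral>\<^sup>+s\<in>{0..t}. ennreal (a s) * ext_infty b (v s) \<partial>lebesgue)"
  defines "w \<equiv> \<lambda>s. enn2real (J s)"
  assumes fin: "J t < \<infinity>"
begin

lemma rhs_mono: "r \<le> s \<Longrightarrow> J r \<le> J s"
  unfolding J_def by (intro add_left_mono nn_set_integral_set_mono) auto

lemma rhs_eq_ennreal: "s \<le> t \<Longrightarrow> J s = ennreal (w s)"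
  using rhs_mono[of s t] fin unfolding w_def by (auto simp: top_unique less_top)

lemma rhs_at_0: "J 0 = ennreal c"
proof -
  have "(\<integral>\<^sup>+s\<in>{0..0}. ennreal (a s) * ext_infty b (v s) \<partial>lebesgue) = 0"
    by (intro nn_integral_null_set) auto
  then show ?thesis unfolding J_def by simp
qed

lemma rhs_real_at_0: "w 0 = c"
  using x0_pos x0_le_c by (simp add: w_def rhs_at_0)

lemma rhs_real_mono: "r \<le> s \<Longrightarrow> s \<le> t \<Longrightarrow> w r \<le> w s"
  unfolding w_def using rhs_mono[of r s] le_less_trans[OF rhs_mono[of s t] fin]
  by (intro enn2real_mono) auto

lemma rhs_real_ge: "0 \<le> s \<Longrightarrow> s \<le> t \<Longrightarrow> x0 \<le> w s"
  using rhs_real_mono[of 0 s] rhs_real_at_0 x0_le_c by simp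

lemma integral_eq_rhs_increment:
  assumes "0 \<le> r" "r \<le> s" "s \<le> t"
  shows "(\<integral>\<^sup>+x\<in>{r<..s}. ennreal (a x) * ext_infty b (v x) \<partial>lebesgue) = ennreal (w s - w r)"
proof -
  have "J s = J r + (\<integral>\<^sup>+x\<in>{r<..s}. ennreal (a x) * ext_infty b (v x) \<partial>lebesgue)"
    unfolding J_def
    by (subst nn_integral_split[OF ext_integrand_measurable[OF v_meas], of r s])
      (use assms in \<open>auto simp: add.assoc\<close>)
  moreover have "w r \<ge> 0" "w s \<ge> w r" using rhs_real_ge[of r] rhs_real_mono assms x0_pos by auto
  ultimately show ?thesis
    using assms by (simp add: rhs_eq_ennreal ennreal_minus[symmetric])
qed

text \<open>Supplies the continuous weight \<open>\<rho>\<close> for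
  \<open>increment_le_from_local\<close>; \<open>v\<close> itself may be discontinuous.\<close>

lemma b_rhs_continuous: "continuous_on {0..t} (\<lambda>s. b (w s))"
proof -
  \<comment> \<open>\<open>enn2real\<close> is additive only on finite values, hence the finiteness
    check before splitting off \<open>c\<close>.\<close>
  have "(\<integral>\<^sup>+s\<in>{0..s}. ennreal (a s) * ext_infty b (v s) \<partial>lebesgue) < \<infinity>" if "s \<le> t" for s
    using le_less_trans[OF rhs_mono[OF that] fin] unfolding J_def by simp
  then have eq: "w s = c + enn2real (\<integral>\<^sup>+s\<in>{0..s}. ennreal (a s) * ext_infty b (v s) \<partial>lebesgue)"
    if "s \<le> t" for s
    using that x0_pos x0_le_c unfolding w_def J_def by (subst enn2real_plus) auto
  have "continuous_on {0..t}
      (\<lambda>s. c + enn2real (\<integral>\<^sup>+s\<in>{0..s}. ennreal (a s) * ext_infty b (v s) \<partial>lebesgue))"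
    using fin unfolding J_def
    by (intro continuous_intros continuous_on_nn_integral_upper ext_integrand_measurable v_meas) auto
  then have "continuous_on {0..t} w"
    by (rule continuous_on_eq) (simp add: eq)
  then show ?thesis
    by (rule continuous_on_compose2[OF b_cont]) (use rhs_real_ge x0_pos in force)
qed

text \<open>On \<open>{r<..s}\<close> one has \<open>v x \<ge> J x \<ge> J r\<close>, so
  \<open>b (v x)\<close> is at least \<open>b (w r)\<close>. Combined with the upper bound for
  increments of \<open>w\<close> by those of \<open>B\<close>, this is the local hypothesis with
  weight \<open>b (w s)\<close>, \<open>G = A\<close> and \<open>F\<close> equal to \<open>B\<close>
  along \<open>w\<close>.\<close>

lemma primA_le_primB:
  assumes super: "\<And>s. 0 \<le> s \<Longrightarrow> J s \<le> v s"
  shows "primA a t \<le> primB b x0 (w t)"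
proof -
  have "primA a t - primA a 0 \<le> primB b x0 (w t) - primB b x0 (w 0)"
  proof (rule increment_le_from_local[OF t_nonneg b_rhs_continuous])
    show "0 < b (w x)" if "x \<in> {0..t}" for x using that rhs_real_ge[of x] x0_pos by (auto intro!: b_pos)
    show "mono_on {0..t} (primA a)"
      using strict_mono_on_imp_mono_on[OF strict_mono_on_primA] by (rule mono_on_subset) auto
    fix r s assume rs: "0 \<le> r" "r \<le> s" "s \<le> t"
    have wr: "0 \<le> w r" using rhs_real_ge[of r] rs x0_pos by simp
    have "ennreal (b (w r) * (primA a s - primA a r))
        = (\<integral>\<^sup>+x\<in>{r<..s}. ennreal (a x) * ennreal (b (w r)) \<partial>lebesgue)"
      unfolding primA_def using rs wr a_pos b_pos[OF wr]
      by (intro set_nn_integral_halfline[OF a_cont, symmetric]) (auto simp: less_imp_le)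
    also have "\<dots> \<le> (\<integral>\<^sup>+x\<in>{r<..s}. ennreal (a x) * ext_infty b (v x) \<partial>lebesgue)"
    proof (intro nn_integral_mono)
      fix x
      have "ennreal (b (w r)) \<le> ext_infty b (v x)" if "x \<in> {r<..s}"
        using that rs wr rhs_mono[of r x] super[of x] rhs_eq_ennreal[of r]
        by (intro ennreal_le_ext_infty[OF b_mono]) auto
      then show "ennreal (a x) * ennreal (b (w r)) * indicator {r<..s} x
          \<le> ennreal (a x) * ext_infty b (v x) * indicator {r<..s} x"
        by (auto simp: indicator_def intro!: mult_left_mono)
    qed
    also have "\<dots> = ennreal (w s - w r)" using integral_eq_rhs_increment rs by simp
    finally have "b (w r) * (primA a s - primA a r) \<le> w s - w r"
      using rhs_real_mono[of r s] rs by (simp add: ennreal_le_iff)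
    also have "\<dots> \<le> b (w s) * (primB b x0 (w s) - primB b x0 (w r))"
      using primB_diff_bounds(2) rhs_real_ge rhs_real_mono rs by simp
    finally show "b (w r) * (primA a s - primA a r)
      \<le> b (w s) * (primB b x0 (w s) - primB b x0 (w r))" .
  qed
  \<comment> \<open>The initial value has the right sign: \<open>B\<close> is 0 at
    \<open>x0\<close>, and \<open>w\<close> starts at \<open>c \<ge> x0\<close>.\<close>
  moreover have "primB b x0 x0 \<le> primB b x0 c"
    using strict_mono_on_leD[OF strict_mono_on_primB] x0_le_c by auto
  ultimately show ?thesis by (simp add: rhs_real_at_0 primA_def primB_def)
qed

text \<open>The mirror image: \<open>b (v x)\<close> is now bounded above by its value at the right
  endpoint, \<open>b (w s)\<close>, and \<open>F\<close> and \<open>G\<close> change roles. For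
  \<open>c = x0\<close> the subtracted initial term is 0.\<close>

lemma primB_le_primA:
  assumes sub: "\<And>s. 0 \<le> s \<Longrightarrow> v s \<le> J s"
  shows "primB b x0 (w t) - primB b x0 c \<le> primA a t"
proof -
  have "primB b x0 (w t) - primB b x0 (w 0) \<le> primA a t - primA a 0"
  proof (rule increment_le_from_local[OF t_nonneg b_rhs_continuous])
    show "0 < b (w x)" if "x \<in> {0..t}" for x using that rhs_real_ge[of x] x0_pos by (auto intro!: b_pos)
    show "mono_on {0..t} (\<lambda>s. primB b x0 (w s))"
      by (intro mono_onI strict_mono_on_leD[OF strict_mono_on_primB]) (auto intro: rhs_real_ge rhs_real_mono)
    fix r s assume rs: "0 \<le> r" "r \<le> s" "s \<le> t"
    have ws: "0 \<le> w s" using rhs_real_ge[of s] rs x0_pos by simp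
    have "ennreal (w s - w r) = (\<integral>\<^sup>+x\<in>{r<..s}. ennreal (a x) * ext_infty b (v x) \<partial>lebesgue)"
      using integral_eq_rhs_increment rs by simp
    also have "\<dots> \<le> (\<integral>\<^sup>+x\<in>{r<..s}. ennreal (a x) * ennreal (b (w s)) \<partial>lebesgue)"
    proof (intro nn_integral_mono)
      fix x
      have "ext_infty b (v x) \<le> ennreal (b (w s))" if "x \<in> {r<..s}"
        using that rs ws rhs_mono[of x s] sub[of x] rhs_eq_ennreal[of s]
        by (intro ext_infty_le_ennreal[OF b_mono]) auto
      then show "ennreal (a x) * ext_infty b (v x) * indicator {r<..s} x
          \<le> ennreal (a x) * ennreal (b (w s)) * indicator {r<..s} x"
        by (auto simp: indicator_def intro!: mult_left_mono)
    qed
    also have "\<dots> = ennreal (b (w s) * (primA a s - primA a r))"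
      unfolding primA_def using rs ws a_pos b_pos[OF ws]
      by (intro set_nn_integral_halfline[OF a_cont]) (auto simp: less_imp_le)
    finally have *: "w s - w r \<le> b (w s) * (primA a s - primA a r)"
      using rs b_pos[OF ws] strict_mono_on_leD[OF strict_mono_on_primA, of r s]
      by (subst (asm) ennreal_le_iff) auto
    have "b (w r) * (primB b x0 (w s) - primB b x0 (w r)) \<le> w s - w r"
      using primB_diff_bounds(1) rhs_real_ge rhs_real_mono rs by simp
    then show "b (w r) * (primB b x0 (w s) - primB b x0 (w r))
      \<le> b (w s) * (primA a s - primA a r)" using * by simp
  qed
  then show ?thesis by (simp add: rhs_real_at_0 primA_def)
qed

end

section \<open>Limits at infinity and inversion of \<open>A\<close>\<close>

lemma primB_le_primB_infty:
  assumes "x0 \<le> x" shows "ennreal (primB b x0 x) \<le> primB_infty b x0"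
proof -
  have "mono_on {x0..} (\<lambda>x. ennreal (primB b x0 x))"
    by (intro mono_onI ennreal_leI strict_mono_on_leD[OF strict_mono_on_primB])
  then show ?thesis
    unfolding primB_infty_def using assms by (subst Lim_at_top_mono_on) (auto intro!: SUP_upper)
qed

text \<open>If \<open>s\<close> is below \<open>A(\<infinity>)\<close>, it is a value of
  \<open>A\<close> by the intermediate value theorem, and strict monotonicity turns
  \<open>A t \<le> s\<close> into a bound on \<open>t\<close>. Otherwise the inverse is infinite by
  convention.\<close>

lemma le_primA_inv:
  assumes "0 \<le> t" "ennreal (primA a t) \<le> s"
  shows "ennreal t \<le> primA_inv a s"
proof (cases "s \<ge> primA_infty a")
  case False
  have "mono_on {0..} (\<lambda>x. ennreal (primA a x))"
    by (intro mono_onI ennreal_leI strict_mono_on_leD[OF strict_mono_on_primA])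
  then have "s < (SUP x\<in>{0..}. ennreal (primA a x))"
    using False unfolding primA_infty_def by (simp add: Lim_at_top_mono_on not_le)
  then obtain x where x: "0 \<le> x" "s < ennreal (primA a x)" by (auto simp: less_SUP_iff)
  obtain s' where s': "s = ennreal s'" "0 \<le> s'" using x by (cases s) auto
  have s'x: "s' \<le> primA a x" using x s' by (auto simp: ennreal_less_iff)
  have "continuous_on {0..x} (primA a)"
    unfolding primA_def using integrable_on_halfline[OF a_cont]
    by (intro indefinite_integral_continuous_1) auto
  then obtain y where y: "0 \<le> y" "primA a y = s'"
    using IVT'[of "primA a" 0 s' x] x s' s'x by (auto simp: primA_def)
  have "the_inv_into {0..} (primA a) s' = y"
    using y by (intro the_inv_into_f_eq strict_mono_on_imp_inj_on strict_mono_on_primA) auto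
  moreover have "t \<le> y"
    using assms y s' strict_mono_onD[OF strict_mono_on_primA, of y t]
    by (auto simp: ennreal_le_iff not_le[symmetric])
  ultimately show ?thesis
    using False s' by (auto simp: primA_inv_def intro!: ennreal_leI)
qed (simp add: primA_inv_def)

end

section \<open>Comparison of the solutions and bound on the explosion time\<close>

theorem theorem4:
  fixes a b :: "real \<Rightarrow> real" and u v :: "real \<Rightarrow> ennreal" and x0 x1 :: real
  assumes a_cont: "continuous_on {0..} a" and a_pos: "\<And>t. 0 \<le> t \<Longrightarrow> 0 < a t"
    and b_cont: "continuous_on {0..} b" and b_pos: "\<And>x. 0 \<le> x \<Longrightarrow> 0 < b x"
    and b_mono: "mono_on {0..} b"
    and x0_pos: "0 < x0" and x0_le_x1: "x0 \<le> x1"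
    and v_meas: "v \<in> borel_measurable (lebesgue_on {0..})"
    and u_cont: "continuous_on {0..} u"
    and v_ineq: "\<And>t. 0 \<le> t \<Longrightarrow>
       v t \<ge> ennreal x1 + (\<integral>\<^sup>+ s\<in>{0..t}. ennreal (a s) * ext_infty b (v s) \<partial>lebesgue)"
    and u_eq: "\<And>t. 0 \<le> t \<Longrightarrow>
       u t = ennreal x0 + (\<integral>\<^sup>+ s\<in>{0..t}. ennreal (a s) * ext_infty b (u s) \<partial>lebesgue)"
  shows "(\<forall>t\<ge>0. v t \<ge> u t) \<and> explosion_time v \<le> primA_inv a (primB_infty b x0)"
proof
  define w where "w t = ennreal x1
    + (\<integral>\<^sup>+s\<in>{0..t}. ennreal (a s) * ext_infty b (v s) \<partial>lebesgue)" for t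
  have w_le_v: "w t \<le> v t" if "0 \<le> t" for t using v_ineq that by (simp add: w_def)
  have w_mono: "w r \<le> w s" if "r \<le> s" for r s
    unfolding w_def using that by (intro add_left_mono nn_set_integral_set_mono) auto
  have A_le_B: "x0 \<le> enn2real (w t) \<and> primA a t \<le> primB b x0 (enn2real (w t))"
    if "0 \<le> t" "w t < \<infinity>" for t
    using primA_le_primB[OF a_cont a_pos b_cont b_pos b_mono x0_pos v_meas x0_le_x1 that(1)]
      rhs_real_ge[OF a_cont a_pos b_cont b_pos b_mono x0_pos v_meas x0_le_x1 that(1), of t]
      that v_ineq by (simp add: w_def)
  have u_meas: "u \<in> borel_measurable (lebesgue_on {0..})"
    using u_cont by (intro continuous_imp_measurable_on_sets_lebesgue) auto
  \<comment> \<open>Here \<open>u\<close> plays the role of \<open>v\<close> with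
    \<open>c = x0\<close>; its equation makes it equal to its own right-hand side.\<close>
  have B_le_A: "x0 \<le> enn2real (u t) \<and> primB b x0 (enn2real (u t)) \<le> primA a t"
    if "0 \<le> t" "u t < \<infinity>" for t
    using primB_le_primA[OF a_cont a_pos b_cont b_pos b_mono x0_pos u_meas order_refl that(1)]
      rhs_real_ge[OF a_cont a_pos b_cont b_pos b_mono x0_pos u_meas order_refl that(1), of t]
      that u_eq by (simp add: primB_def)
  have u_le_w: "u t \<le> w t" if t: "0 \<le> t" "u t < \<infinity>" for t
  proof (cases "w t < \<infinity>")
    case True
    \<comment> \<open>Otherwise strict monotonicity of \<open>B\<close> would give
      \<open>A t \<le> B (w t) < B (u t) \<le> A t\<close>.\<close>
    have "\<not> enn2real (w t) < enn2real (u t)"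
      using A_le_B[OF t(1) True] B_le_A[OF t]
        strict_mono_onD[OF strict_mono_on_primB[OF a_cont a_pos b_cont b_pos b_mono x0_pos],
          of "enn2real (w t)" "enn2real (u t)"] by auto
    then show ?thesis using True t by (cases "u t"; cases "w t") (auto intro!: ennreal_leI)
  qed (simp add: less_top[symmetric])
  have "u t \<le> w t" if t: "0 \<le> t" for t
  proof (rule ccontr)
    assume "\<not> u t \<le> w t"
    then have "w t < \<infinity>" and "u t = \<infinity>"
      using u_le_w[OF t] by (auto simp: not_le less_top[symmetric] intro: less_le_trans dest: leD)
    \<comment> \<open>The level \<open>w t + 1\<close> is finite and strictly above
      \<open>w t\<close>, while \<open>u 0 = x0 \<le> x1 \<le> w t\<close>. A continuous
      \<open>u\<close> reaching infinity at \<open>t\<close> must attain this level at some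
      \<open>s \<le> t\<close>, where the finite case gives
      \<open>u s \<le> w s \<le> w t\<close>.\<close>
    have "u 0 \<le> w t + 1"
      using u_eq[of 0] x0_le_x1
      by (auto simp: w_def nn_integral_null_set add.assoc intro!: add_increasing2 ennreal_leI)
    then obtain s where s: "0 \<le> s" "s \<le> t" "u s = w t + 1"
      using IVT'[of u 0 "w t + 1" t] t \<open>u t = \<infinity>\<close> continuous_on_subset[OF u_cont, of "{0..t}"] by auto
    have "u s < \<infinity>" using \<open>w t < \<infinity>\<close> by (simp add: s)
    then have "u s \<le> w t"
      by (rule order_trans[OF u_le_w[OF s(1)] w_mono[OF s(2)]])
    then have "w t + 1 \<le> w t" by (simp only: s)
    \<comment> \<open>Cancelling \<open>w t\<close> is legitimate only because it is finite.\<close>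
    then show False using \<open>w t < \<infinity>\<close> using ennreal_add_left_cancel_le[of "w t" 1 0] by (simp add: less_top)
  qed
  then show "\<forall>t\<ge>0. v t \<ge> u t" using w_le_v order_trans by blast
  show "explosion_time v \<le> primA_inv a (primB_infty b x0)"
    unfolding explosion_time_def
  proof (rule SUP_least)
    fix t assume "t \<in> {t. 0 \<le> t \<and> v t < \<infinity>}"
    then have t: "0 \<le> t" "w t < \<infinity>" using w_le_v[of t] by (auto intro: le_less_trans)
    have "ennreal (primA a t) \<le> primB_infty b x0"
      using A_le_B[OF t] primB_le_primB_infty[OF a_cont a_pos b_cont b_pos b_mono x0_pos,
          of "enn2real (w t)"] by (auto intro: order_trans ennreal_leI)
    then show "ennreal t \<le> primA_inv a (primB_infty b x0)"
      using t by (intro le_primA_inv[OF a_cont a_pos b_cont b_pos b_mono x0_pos])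
  qed
qed

end
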